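(* Let $G=(V,E)$ be a finite simple graph with $|V|=n\ge 2$ vertices, let $\lambda_2(G)$ be the second smallest eigenvalue of its Laplacian, and let $k\ge 0$ be an integer. If $\lambda_2(G)>\frac{kn}{k+1}$, then $\tilde H^k(X(G);\mathbb{R})=0$, where $X(G)$ is the flag complex of $G$.
   Context: The Laplacian of $G$ is the $V\times V$ matrix $L_G$ with $L_G(u,u)=\deg(u)$, $L_G(u,v)=-1$ if $uv\in E$, and $L_G(u,v)=0$ otherwise. Its eigenvalues, with multiplicity, are $0=\lambda_1(G)\le\lambda_2(G)\le\dots\le\lambda_n(G)$. The flag complex $X(G)$ is the simplicial complex on $V$ whose simplices are all subsets of $V$ that span a complete subgraph of $G$. $\tilde H^k(\cdot;\mathbb{R})$ is reduced simplicial cohomology with real coefficients. *)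

theory Defs
  imports "HOL-Analysis.Analysis" "HOL-Computational_Algebra.Computational_Algebra"
    "HOL-Algebra.Elementary_Groups"
begin

text \<open>A graph has the vertex set \<open>V = UNIV :: 'v set\<close> for a finite type \<open>'v\<close> and is given by its
  set \<open>E\<close> of edges, each an unordered pair of distinct vertices.\<close>

definition simple_graph :: "'v::finite set set \<Rightarrow> bool" where
  "simple_graph E \<longleftrightarrow> (\<forall>e\<in>E. card e = 2)"

definition vertex_degree :: "'v::finite set set \<Rightarrow> 'v \<Rightarrow> nat" where
  "vertex_degree E u = card {v. {u, v} \<in> E}"

definition laplacian :: "'v::finite set set \<Rightarrow> real ^ 'v ^ 'v" where
  "laplacian E =
    (\<chi> u v. if u = v then real (vertex_degree E u) else if {u, v} \<in> E then -1 else 0)"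

definition characteristic_poly :: "real ^ 'n ^ 'n \<Rightarrow> real poly" where
  "characteristic_poly A = det (\<chi> i j. (if i = j then [:0, 1:] else 0) - [:A $ i $ j:])"

text \<open>The real eigenvalues in increasing order, each repeated according to its multiplicity as a root
  of the characteristic polynomial. A symmetric matrix, such as the Laplacian, has only real
  eigenvalues, so for it the list has length \<open>CARD('n)\<close>.\<close>

definition eigenvalue_list :: "real ^ 'n ^ 'n \<Rightarrow> real list" where
  "eigenvalue_list A = sorted_list_of_multiset (proots (characteristic_poly A))"

text \<open>The eigenvalues \<open>\<lambda>\<^sub>1 \<le> \<dots> \<le> \<lambda>\<^sub>n\<close> are numbered from 1, list positions from 0.\<close>

definition laplacian_eigenvalue :: "nat \<Rightarrow> 'v::finite set set \<Rightarrow> real" where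
  "laplacian_eigenvalue i E = eigenvalue_list (laplacian E) ! (i - 1)"

text \<open>The empty set is a simplex of the flag complex; it is the simplex of dimension \<open>-1\<close>.\<close>

definition flag_complex :: "'v::finite set set \<Rightarrow> 'v set set" where
  "flag_complex E = {s. \<forall>u\<in>s. \<forall>v\<in>s. u \<noteq> v \<longrightarrow> {u, v} \<in> E}"

text \<open>Simplicial cochains of a complex \<open>K\<close> (a set of simplices) are the alternating functions on
  ordered simplices, extended by zero to all lists of vertices. Degrees are integers: the cochains
  of degree \<open>-1\<close> are the functions on the empty simplex, which makes the cohomology reduced.\<close>

definition ordered_simplices :: "'v set set \<Rightarrow> 'v list set" where
  "ordered_simplices K = {xs. distinct xs \<and> set xs \<in> K}"

definition alternating :: "('v list \<Rightarrow> real) \<Rightarrow> bool" where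
  "alternating \<phi> \<longleftrightarrow> (\<forall>xs i j. i < length xs \<longrightarrow> j < length xs \<longrightarrow> i \<noteq> j \<longrightarrow>
     \<phi> (xs[i := xs ! j, j := xs ! i]) = - \<phi> xs)"

definition cochains :: "int \<Rightarrow> 'v set set \<Rightarrow> ('v list \<Rightarrow> real) set" where
  "cochains k K = {\<phi>. alternating \<phi> \<and>
     (\<forall>xs. \<phi> xs \<noteq> 0 \<longrightarrow> xs \<in> ordered_simplices K \<and> int (length xs) = k + 1)}"

definition coboundary :: "'v set set \<Rightarrow> ('v list \<Rightarrow> real) \<Rightarrow> 'v list \<Rightarrow> real" where
  "coboundary K \<phi> xs =
    (if xs \<in> ordered_simplices K
     then \<Sum>i<length xs. (-1) ^ i * \<phi> (take i xs @ drop (Suc i) xs) else 0)"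

definition cocycles :: "int \<Rightarrow> 'v set set \<Rightarrow> ('v list \<Rightarrow> real) set" where
  "cocycles k K = {\<phi> \<in> cochains k K. coboundary K \<phi> = (\<lambda>_. 0)}"

definition coboundaries :: "int \<Rightarrow> 'v set set \<Rightarrow> ('v list \<Rightarrow> real) set" where
  "coboundaries k K = coboundary K ` cochains (k - 1) K"

definition cocycle_group :: "int \<Rightarrow> 'v set set \<Rightarrow> ('v list \<Rightarrow> real) monoid" where
  "cocycle_group k K =
    \<lparr>carrier = cocycles k K, mult = (\<lambda>\<phi> \<psi> xs. \<phi> xs + \<psi> xs), one = (\<lambda>_. 0)\<rparr>"

definition reduced_cohomology_group :: "int \<Rightarrow> 'v set set \<Rightarrow> ('v list \<Rightarrow> real) set monoid" where
  "reduced_cohomology_group k K = cocycle_group k K Mod coboundaries k K"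

end

theory Submission imports Defs begin

text \<open>
  The proof is a Bochner argument that compares a harmonic cochain with the graph Laplacian on every
  link at once. By the Hodge decomposition (\<open>cocycle_eq_coboundary_plus_harmonic\<close>), every \<open>k\<close>-cocycle
  is a coboundary plus a cocycle \<open>h\<close> that satisfies \<open>(\<Sum>v. h (v # y)) = 0\<close> for all lists \<open>y\<close>. It
  remains to show that \<open>h = 0\<close>.

  Fix an ordered \<open>(k - 1)\<close>-simplex \<open>y\<close> and regard \<open>f v = h (v # y)\<close> as a function on the vertices of
  \<open>G\<close>. It is orthogonal to the constants, so the variational description of the second eigenvalue
  gives
  \<open>\<lambda>\<^sub>2 * (\<Sum>v. (f v)\<^sup>2) \<le> (\<Sum>v. deg v * (f v)\<^sup>2) - (\<Sum>u. \<Sum>w. [u \<sim> w] * f u * f w)\<close>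
  (\<open>laplacian_eigenvalue_2_le\<close>). These inequalities are summed over all \<open>y\<close>. Let \<open>N\<close> be the sum of
  \<open>(h x)\<^sup>2\<close> over all lists \<open>x\<close> of length \<open>k + 1\<close>. After multiplication by \<open>k + 1\<close>,

  \<^item> the left-hand side is \<open>(k + 1) * \<lambda>\<^sub>2 * N\<close>;

  \<^item> the degree term is \<open>\<Sum>x. (h x)\<^sup>2 * (\<Sum>i. deg (x\<^sub>i))\<close>, because \<open>h\<^sup>2\<close> is symmetric
    (\<open>sum_symmetric_mult_sum_list\<close>);

  \<^item> the mixed term is \<open>\<Sum>x. (h x)\<^sup>2 * c x\<close>, where \<open>c x\<close> is the number of common neighbours of the
    vertices of \<open>x\<close> (\<open>sum_common_neighbours_cocycle\<close>). Indeed, if \<open>v\<close> is a common neighbour, then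
    \<open>v # x\<close> is a simplex of the flag complex, and the cocycle condition at \<open>v # x\<close> writes \<open>h x\<close> as
    an alternating sum of the values of \<open>h\<close> at \<open>v\<close> followed by a face of \<open>x\<close>.

  A vertex that is adjacent to all \<open>k + 1\<close> entries of \<open>x\<close> contributes \<open>k + 1 - 1\<close> to
  \<open>(\<Sum>i. deg (x\<^sub>i)) - c x\<close>, and any other vertex contributes at most \<open>k\<close>; so this difference is at
  most \<open>k * n\<close>. Hence \<open>(k + 1) * \<lambda>\<^sub>2 * N \<le> k * n * N\<close>, and \<open>\<lambda>\<^sub>2 > k * n / (k + 1)\<close> forces
  \<open>N = 0\<close>.
\<close>

section \<open>Eigenvectors and the roots of the characteristic polynomial\<close>

lemma poly_det:
  fixes M :: "'a::comm_ring_1 poly ^ 'n ^ 'n"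
  shows "poly (det M) t = det (\<chi> i j. poly (M $ i $ j) t)"
  by (simp add: det_def poly_sum poly_prod)

lemma poly_characteristic_poly: "poly (characteristic_poly A) t = det (mat t - A)"
  unfolding characteristic_poly_def poly_det
  by (rule arg_cong[where f = det]) (simp add: vec_eq_iff mat_def)

text \<open>Cramer's rule in the form that extracts a scalar: if \<open>M *v x\<close> is a multiple of \<open>y\<close>, then
  putting \<open>y\<close> into a column of \<open>M\<close> exhibits \<open>c\<close> as a factor of \<open>x $ j * det M\<close>. For \<open>M = mat t - A\<close> and an
  eigenvector \<open>x\<close>, the factor is linear in \<open>t\<close>.\<close>

lemma det_mult_vec_replace_column:
  fixes M :: "real ^ 'n ^ 'n"
  assumes "M *v x = c *\<^sub>R y"
  shows "x $ j * det M = c * det (\<chi> i l. if l = j then y $ i else M $ i $ l)"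
proof -
  define N :: "real ^ 'n ^ 'n" where "N = (\<chi> i l. if l = j then y $ i else M $ i $ l)"
  have N: "N *v axis j c = c *\<^sub>R y"
    by (simp add: vec_eq_iff matrix_vector_mult_def N_def axis_def if_distrib cong: if_cong)
  have "c * det N = det (\<chi> i l. if l = j then (c *\<^sub>R y) $ i else N $ i $ l)"
    using cramer_lemma[where A = N and x = "axis j c" and k = j, unfolded N] by (simp add: axis_def)
  also have "(\<chi> i l. if l = j then (c *\<^sub>R y) $ i else N $ i $ l)
      = (\<chi> i l. if l = j then (M *v x) $ i else M $ i $ l)"
    by (simp add: vec_eq_iff N_def assms)
  also have "det \<dots> = x $ j * det M"
    by (rule cramer_lemma)
  finally show ?thesis
    by (simp add: N_def)
qed

lemma mat_diff_mult_eigenvector: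
  fixes A :: "real ^ 'n ^ 'n"
  assumes "A *v u = a *\<^sub>R u"
  shows "(mat t - A) *v u = (t - a) *\<^sub>R u"
proof -
  have "mat t *v u = t *\<^sub>R u"
    by (simp add: vec_eq_iff matrix_vector_mult_def mat_def if_distrib[where f = "\<lambda>c. c * _"] cong: if_cong)
  then show ?thesis
    using assms by (simp add: matrix_vector_mult_diff_rdistrib algebra_simps)
qed

lemma poly_characteristic_poly_eigenvalue:
  fixes A :: "real ^ 'n ^ 'n"
  assumes "A *v u = a *\<^sub>R u" "u \<noteq> 0"
  shows "poly (characteristic_poly A) a = 0"
proof -
  obtain j where "u $ j \<noteq> 0"
    using assms(2) by (auto simp: vec_eq_iff)
  then show ?thesis
    using det_mult_vec_replace_column[OF mat_diff_mult_eigenvector[OF assms(1), of a], of j]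
    by (simp add: poly_characteristic_poly)
qed

text \<open>Geometric multiplicity two forces algebraic multiplicity two. Cramer's rule is applied twice:
  an eigenvector \<open>u\<close> with \<open>u $ j \<noteq> 0\<close> replaces column \<open>j\<close> of \<open>mat t - A\<close> and extracts one factor
  \<open>t - a\<close>. An eigenvector \<open>w\<close> with \<open>w $ j = 0\<close> does not see that replacement and extracts another
  factor from a second column.\<close>

lemma double_eigenvalue_dvd_characteristic_poly:
  fixes A :: "real ^ 'n ^ 'n"
  assumes u: "A *v u = a *\<^sub>R u" "u \<noteq> 0" and v: "A *v v = a *\<^sub>R v" "\<And>c. v \<noteq> c *\<^sub>R u"
  shows "[:- a, 1:] ^ 2 dvd characteristic_poly A"
proof -
  obtain j where j: "u $ j \<noteq> 0"
    using u(2) by (auto simp: vec_eq_iff)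
  define w where "w = v - (v $ j / u $ j) *\<^sub>R u"
  have w: "A *v w = a *\<^sub>R w"
    by (simp add: w_def matrix_vector_mult_diff_distrib matrix_vector_mult_scaleR u v algebra_simps)
  have wj: "w $ j = 0"
    using j by (simp add: w_def)
  have "w \<noteq> 0"
    using v(2) by (simp add: w_def)
  then obtain l where l: "w $ l \<noteq> 0"
    by (auto simp: vec_eq_iff)
  define Q :: "real poly ^ 'n ^ 'n" where
    "Q = (\<chi> i m. if m = l then [:w $ i:] else if m = j then [:u $ i:]
            else (if i = m then [:0, 1:] else 0) - [:A $ i $ m:])"
  have "poly (smult (u $ j * w $ l) (characteristic_poly A)) t = poly ([:- a, 1:] ^ 2 * det Q) t" for t
  proof -
    define N :: "real ^ 'n ^ 'n" where
      "N = (\<chi> i m. if m = j then u $ i else (mat t - A) $ i $ m)"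
    have "(\<Sum>m\<in>UNIV. N $ i $ m * w $ m) = (\<Sum>m\<in>UNIV. (mat t - A) $ i $ m * w $ m)" for i
      by (rule sum.cong) (auto simp: N_def wj)
    then have "N *v w = (mat t - A) *v w"
      by (simp add: vec_eq_iff matrix_vector_mult_def)
    then have "N *v w = (t - a) *\<^sub>R w"
      by (simp add: mat_diff_mult_eigenvector[OF w])
    then have "w $ l * det N = (t - a) * det (\<chi> i m. if m = l then w $ i else N $ i $ m)"
      by (rule det_mult_vec_replace_column)
    also have "(\<chi> i m. if m = l then w $ i else N $ i $ m) = (\<chi> i m. poly (Q $ i $ m) t)"
      by (auto simp: vec_eq_iff N_def Q_def mat_def)
    finally have 2: "w $ l * det N = (t - a) * poly (det Q) t"
      by (simp add: poly_det)
    have 1: "u $ j * det (mat t - A) = (t - a) * det N"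
      unfolding N_def by (rule det_mult_vec_replace_column[OF mat_diff_mult_eigenvector[OF u(1)]])
    have "u $ j * w $ l * det (mat t - A) = w $ l * (u $ j * det (mat t - A))"
      by simp
    also have "\<dots> = (t - a) * (w $ l * det N)"
      unfolding 1 by simp
    also have "\<dots> = (t - a)^2 * poly (det Q) t"
      unfolding 2 by (simp add: power2_eq_square)
    finally show ?thesis
      by (simp add: poly_characteristic_poly)
  qed
  then have "smult (u $ j * w $ l) (characteristic_poly A) = [:- a, 1:] ^ 2 * det Q"
    by (metis poly_eq_poly_eq_iff ext)
  then have "[:- a, 1:] ^ 2 dvd smult (u $ j * w $ l) (characteristic_poly A)"
    by simp
  then show ?thesis
    using j l by (simp add: dvd_smult_iff)
qed

lemma two_eigenvectors_subseteq_proots: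
  fixes A :: "real ^ 'n ^ 'n"
  assumes p: "characteristic_poly A \<noteq> 0"
    and u: "A *v u = a *\<^sub>R u" "u \<noteq> 0" and v: "A *v v = b *\<^sub>R v" "v \<noteq> 0" and uv: "u \<bullet> v = 0"
  shows "{#a, b#} \<subseteq># proots (characteristic_poly A)"
proof (cases "a = b")
  case True
  have "v \<noteq> c *\<^sub>R u" for c
    using uv u(2) v(2) by auto
  then have "2 \<le> Polynomial.order a (characteristic_poly A)"
    using double_eigenvalue_dvd_characteristic_poly[OF u] v(1) True p
    by (simp add: order_divides)
  then have "2 \<le> count (proots (characteristic_poly A)) a"
    using p by simp
  then show ?thesis
    by (simp add: True[symmetric] subseteq_mset_def)
next
  case False
  have "a \<in># proots (characteristic_poly A)" "b \<in># proots (characteristic_poly A)"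
    using p poly_characteristic_poly_eigenvalue[OF u] poly_characteristic_poly_eigenvalue[OF v]
    by simp_all
  then show ?thesis
    using False by (simp add: insert_subset_eq_iff in_diff_count)
qed

text \<open>Since \<open>M\<close> has two entries that are at most \<open>max a b\<close>, its second smallest entry is at most
  \<open>max a b\<close>.\<close>

lemma second_of_sorted_list_of_multiset_le:
  fixes M :: "'a::linorder multiset"
  assumes "{#a, b#} \<subseteq># M"
  shows "sorted_list_of_multiset M ! 1 \<le> max a b"
proof -
  define xs where "xs = sorted_list_of_multiset M"
  have sub: "{#a, b#} \<subseteq># mset xs" and sorted: "sorted xs"
    using assms by (simp_all add: xs_def)
  obtain x y zs where xs: "xs = x # y # zs"
    using size_mset_mono[OF sub] by (cases xs; cases "tl xs") auto
  have "a \<in> set (y # zs) \<or> b \<in> set (y # zs)"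
  proof (rule ccontr)
    assume *: "\<not> ?thesis"
    then have "a = x" "b = x"
      using sub xs by (auto dest: mset_subset_eqD simp: insert_subset_eq_iff)
    then show False
      using sub * xs by (simp add: insert_subset_eq_iff)
  qed
  then have "y \<le> a \<or> y \<le> b"
    using sorted xs by auto
  then show ?thesis
    unfolding xs_def[symmetric] xs by (auto simp: le_max_iff_disj)
qed

text \<open>The Rayleigh quotient attains its minimum \<open>m\<close> on the compact unit sphere of \<open>S\<close>, at some \<open>u\<close>.
  The quadratic form of \<open>A - m\<close> is nonnegative on \<open>S\<close> and vanishes at \<open>u\<close>. Its first variation at
  \<open>u\<close> in the direction \<open>w = A *v u - m *\<^sub>R u\<close>, which lies in \<open>S\<close>, is \<open>2 * (w \<bullet> w)\<close>; hence \<open>w = 0\<close>.\<close>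

lemma symmetric_matrix_minimal_eigenvector:
  fixes A :: "real ^ 'n ^ 'n"
  assumes sym: "transpose A = A"
    and S: "subspace S" "S \<noteq> {0}" and inv: "\<And>x. x \<in> S \<Longrightarrow> A *v x \<in> S"
  obtains u m where "u \<in> S" "u \<noteq> 0" "A *v u = m *\<^sub>R u"
    "\<And>x. x \<in> S \<Longrightarrow> m * (x \<bullet> x) \<le> x \<bullet> (A *v x)"
proof -
  have c1: "compact (sphere 0 1 \<inter> S)"
    by (intro compact_Int_closed closed_subspace S) simp
  have c2: "sphere 0 1 \<inter> S \<noteq> {}"
  proof -
    obtain x where x: "x \<in> S" "x \<noteq> 0"
      using S subspace_0 by blast
    then have "(1 / norm x) *\<^sub>R x \<in> sphere 0 1 \<inter> S"
      using S by (simp add: subspace_scale)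
    then show ?thesis
      by blast
  qed
  have c3: "continuous_on (sphere 0 1 \<inter> S) (\<lambda>x. x \<bullet> (A *v x))"
    by (intro continuous_intros matrix_vector_mult_linear_continuous_on)
  obtain u where u: "u \<in> sphere 0 1 \<inter> S"
    and min: "\<And>x. x \<in> sphere 0 1 \<inter> S \<Longrightarrow> u \<bullet> (A *v u) \<le> x \<bullet> (A *v x)"
    using continuous_attains_inf[OF c1 c2 c3] by blast
  define m where "m = u \<bullet> (A *v u)"
  have uS: "u \<in> S" and uu: "u \<bullet> u = 1"
    using u by (auto simp: norm_eq_1)
  have le: "m * (x \<bullet> x) \<le> x \<bullet> (A *v x)" if "x \<in> S" for x
  proof (cases "x = 0")
    case False
    define z where "z = (1 / norm x) *\<^sub>R x"
    have "z \<in> sphere 0 1 \<inter> S"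
      using that False S by (simp add: z_def subspace_scale)
    then have "m \<le> z \<bullet> (A *v z)"
      using min by (simp add: m_def)
    also have "\<dots> = x \<bullet> (A *v x) / (norm x)^2"
      by (simp add: z_def matrix_vector_mult_scaleR power2_eq_square)
    finally show ?thesis
      using False by (simp add: field_simps power2_norm_eq_inner)
  qed simp
  have swap: "x \<bullet> (A *v y) = y \<bullet> (A *v x)" for x y
    by (metis dot_lmul_matrix inner_commute sym vector_transpose_matrix)
  define w where "w = A *v u - m *\<^sub>R u"
  have wS: "w \<in> S"
    using uS inv S by (simp add: w_def subspace_diff subspace_scale)
  have "w \<bullet> w = 0"
  proof (rule ccontr)
    assume "w \<bullet> w \<noteq> 0"
    then have pos: "w \<bullet> w > 0"
      using inner_ge_zero[of w] by linarith
    define c where "c = w \<bullet> (A *v w) - m * (w \<bullet> w)"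
    have quad: "0 \<le> 2 * t * (w \<bullet> w) + t^2 * c" for t
    proof -
      have "u + t *\<^sub>R w \<in> S"
        using uS wS S by (simp add: subspace_add subspace_scale)
      from le[OF this] have "0 \<le> (u + t *\<^sub>R w) \<bullet> (A *v (u + t *\<^sub>R w)) - m * ((u + t *\<^sub>R w) \<bullet> (u + t *\<^sub>R w))"
        by simp
      also have "\<dots> = 2 * t * (w \<bullet> (A *v u) - m * (w \<bullet> u)) + t^2 * c"
        using swap[of u w] uu
        by (simp add: c_def m_def matrix_vector_right_distrib matrix_vector_mult_scaleR inner_add_left
            inner_add_right algebra_simps power2_eq_square inner_commute[of u w])
      also have "w \<bullet> (A *v u) - m * (w \<bullet> u) = w \<bullet> w"
        by (simp add: w_def inner_diff_right)
      finally show ?thesis .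
    qed
    \<comment> \<open>For negative \<open>t\<close> of small absolute value the linear term of \<open>quad\<close> dominates.\<close>
    define t where "t = - (w \<bullet> w) / (\<bar>c\<bar> + 1)"
    have "t < 0" "t * (\<bar>c\<bar> + 1) = - (w \<bullet> w)"
      using pos by (simp_all add: t_def divide_neg_pos)
    moreover have "2 * t * (w \<bullet> w) + t^2 * c = t * (2 * (w \<bullet> w) + t * c)"
      by (simp add: power2_eq_square algebra_simps)
    moreover have "t * c \<ge> t * (\<bar>c\<bar> + 1)"
      using \<open>t < 0\<close> by (intro mult_left_mono_neg) auto
    ultimately have "2 * t * (w \<bullet> w) + t^2 * c < 0"
      using pos by (smt (verit) mult_neg_pos)
    then show False
      using quad[of t] by simp
  qed
  then have "A *v u = m *\<^sub>R u"
    by (simp add: w_def)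
  moreover have "u \<noteq> 0"
    using uu by auto
  ultimately show ?thesis
    using that uS le by blast
qed

section \<open>The second eigenvalue of the graph Laplacian\<close>

lemma vertex_degree_eq_sum: "real (vertex_degree E u) = (\<Sum>w\<in>UNIV. of_bool ({u, w} \<in> E))"
  by (simp add: vertex_degree_def of_bool_def sum.If_cases Collect_conj_eq)

lemma laplacian_mult_vec:
  assumes "simple_graph E"
  shows "(laplacian E *v f) $ u = (\<Sum>w\<in>UNIV. of_bool ({u, w} \<in> E) * (f $ u - f $ w))"
proof -
  have "{u} \<notin> E"
    using assms by (auto simp: simple_graph_def)
  then have "(laplacian E *v f) $ u
      = (\<Sum>w\<in>UNIV. (if u = w then real (vertex_degree E u) * f $ u else 0) - of_bool ({u, w} \<in> E) * f $ w)"
    by (auto simp: laplacian_def matrix_vector_mult_def intro!: sum.cong)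
  then show ?thesis
    by (simp add: sum_subtractf vertex_degree_eq_sum sum_distrib_right right_diff_distrib)
qed

lemma laplacian_quadratic_form:
  assumes "simple_graph E"
  shows "f \<bullet> (laplacian E *v f)
    = (\<Sum>u\<in>UNIV. \<Sum>w\<in>UNIV. of_bool ({u, w} \<in> E) * (f $ u * (f $ u - f $ w)))"
  unfolding inner_vec_def
  by (simp add: laplacian_mult_vec[OF assms] sum_distrib_left mult.left_commute del: sum_of_bool_mult_eq sum_mult_of_bool_eq)

text \<open>Exchanging the two ends of every edge and averaging turns the quadratic form into half the sum
  of the squares \<open>(f $ u - f $ w)\<^sup>2\<close> over ordered pairs of adjacent vertices.\<close>

lemma laplacian_nonneg:
  assumes "simple_graph E"
  shows "0 \<le> f \<bullet> (laplacian E *v f)"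
proof -
  let ?g = "\<lambda>u w. of_bool ({u, w} \<in> E) * (f $ u * (f $ u - f $ w))"
  have "2 * (f \<bullet> (laplacian E *v f)) = (\<Sum>u\<in>UNIV. \<Sum>w\<in>UNIV. ?g u w) + (\<Sum>u\<in>UNIV. \<Sum>w\<in>UNIV. ?g w u)"
    unfolding laplacian_quadratic_form[OF assms] mult_2
    by (subst (2) sum.swap) simp
  also have "\<dots> = (\<Sum>u\<in>UNIV. \<Sum>w\<in>UNIV. of_bool ({u, w} \<in> E) * (f $ u - f $ w)^2)"
    by (auto simp: sum.distrib[symmetric] insert_commute algebra_simps power2_eq_square intro!: sum.cong)
  also have "\<dots> \<ge> 0"
    by (intro sum_nonneg) simp
  finally show ?thesis
    by simp
qed

text \<open>The minimum \<open>m \<ge> 0\<close> of the Rayleigh quotient on the functions with sum zero is an eigenvalue, and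
  the constant functions give the eigenvalue \<open>0\<close>. The two eigenvectors are orthogonal, so \<open>0\<close> and \<open>m\<close>
  both occur in the list of eigenvalues, even with multiplicity two if \<open>m = 0\<close>; thus \<open>\<lambda>\<^sub>2 \<le> m\<close>.\<close>

lemma laplacian_eigenvalue_2_le:
  fixes f :: "real ^ 'v::finite"
  assumes E: "simple_graph E" and f: "(\<Sum>v\<in>UNIV. f $ v) = 0"
  shows "laplacian_eigenvalue 2 E * (f \<bullet> f) \<le> f \<bullet> (laplacian E *v f)"
proof (cases "f = 0")
  case False
  let ?L = "laplacian E"
  define S where "S = {x :: real ^ 'v. 1 \<bullet> x = 0}"
  have one: "?L *v 1 = 0"
    by (simp add: vec_eq_iff laplacian_mult_vec[OF E])
  have sym: "transpose ?L = ?L"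
    by (simp add: transpose_def laplacian_def vec_eq_iff insert_commute)
  have "subspace S"
    by (simp add: S_def subspace_hyperplane)
  moreover have fS: "f \<in> S"
    using f by (simp add: S_def inner_vec_def)
  then have "S \<noteq> {0}"
    using False by blast
  moreover have "?L *v x \<in> S" for x
    by (metis (mono_tags, lifting) S_def dot_lmul_matrix inner_zero_left mem_Collect_eq one sym
        vector_transpose_matrix)
  ultimately obtain u m where u: "u \<in> S" "u \<noteq> 0" "?L *v u = m *\<^sub>R u"
    and le: "\<And>x. x \<in> S \<Longrightarrow> m * (x \<bullet> x) \<le> x \<bullet> (?L *v x)"
    using symmetric_matrix_minimal_eigenvector[OF sym] by metis
  have "m * (u \<bullet> u) \<ge> 0"
    using laplacian_nonneg[OF E, of u] u(3) by simp
  then have m: "m \<ge> 0"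
    using u(2) by (simp add: zero_le_mult_iff) (metis inner_gt_zero_iff not_le)
  \<comment> \<open>The roots of the zero polynomial form the empty multiset. The value at \<open>- 1\<close> is nonzero because
    \<open>- 1\<close> is not an eigenvalue of the positive semidefinite matrix \<open>?L\<close>.\<close>
  have "characteristic_poly ?L \<noteq> 0"
  proof
    assume "characteristic_poly ?L = 0"
    then have "det (mat (- 1) - ?L) = 0"
      by (simp flip: poly_characteristic_poly)
    then obtain x where x: "x \<noteq> 0" "(mat (- 1) - ?L) *v x = 0"
      by (metis invertible_det_nz invertible_left_inverse matrix_left_invertible_ker)
    have "mat (- 1) *v x = - x"
      by (simp add: vec_eq_iff matrix_vector_mult_def mat_def if_distrib[where f = "\<lambda>c. c * _"] cong: if_cong)
    then have "?L *v x = - x"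
      using x(2) by (simp add: matrix_vector_mult_diff_rdistrib)
    then show False
      using laplacian_nonneg[OF E, of x] x(1) inner_gt_zero_iff[of x]
      by (simp del: inner_gt_zero_iff)
  qed
  then have "{#0, m#} \<subseteq># proots (characteristic_poly ?L)"
    using u one by (intro two_eigenvectors_subseteq_proots[of _ 1 _ u]) (auto simp: S_def)
  then have "laplacian_eigenvalue 2 E \<le> max 0 m"
    unfolding laplacian_eigenvalue_def eigenvalue_list_def
    by (simp only: second_of_sorted_list_of_multiset_le diff_Suc_1 numeral_2_eq_2 flip: One_nat_def)
  then have "laplacian_eigenvalue 2 E * (f \<bullet> f) \<le> m * (f \<bullet> f)"
    using m by (intro mult_right_mono) auto
  then show ?thesis
    using le[OF fS] by linarith
qed simp

section \<open>Alternating functions on lists\<close>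

text \<open>This is the coboundary on arbitrary lists of vertices. Without the restriction to the simplices
  of a complex, it satisfies a recursion over the list.\<close>

definition faces_sum :: "('v list \<Rightarrow> real) \<Rightarrow> 'v list \<Rightarrow> real" where
  "faces_sum g xs = (\<Sum>i<length xs. (-1) ^ i * g (take i xs @ drop (Suc i) xs))"

lemma faces_sum_Nil [simp]: "faces_sum g [] = 0"
  by (simp add: faces_sum_def)

lemma faces_sum_Cons [simp]: "faces_sum g (x # xs) = g xs - faces_sum (\<lambda>ys. g (x # ys)) xs"
  by (simp add: faces_sum_def sum.lessThan_Suc_shift sum_negf del: sum.lessThan_Suc)

lemma faces_sum_zero [simp]: "faces_sum (\<lambda>_. 0) xs = 0"
  by (simp add: faces_sum_def)

lemma faces_sum_add: "faces_sum (\<lambda>ys. f ys + g ys) xs = faces_sum f xs + faces_sum g xs"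
  by (simp add: faces_sum_def sum.distrib algebra_simps)

lemma faces_sum_diff: "faces_sum (\<lambda>ys. f ys - g ys) xs = faces_sum f xs - faces_sum g xs"
  by (simp add: faces_sum_def sum_subtractf algebra_simps)

lemma faces_sum_scale: "faces_sum (\<lambda>ys. c * g ys) xs = c * faces_sum g xs"
  by (simp add: faces_sum_def sum_distrib_left algebra_simps)

text \<open>Removing two vertices in either order gives opposite signs. The recursion over the list reduces
  this to a cancellation in the first vertex.\<close>

lemma faces_sum_faces_sum: "faces_sum (faces_sum g) xs = 0"
proof (induction xs arbitrary: g)
  case (Cons x xs)
  then show ?case
    by (simp add: faces_sum_diff)
qed simp

lemma alternating_adjacent:
  assumes "alternating \<phi>"
  shows "\<phi> (as @ x # y # bs) = - \<phi> (as @ y # x # bs)"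
proof -
  let ?xs = "as @ y # x # bs"
  have "\<phi> (?xs[length as := ?xs ! Suc (length as), Suc (length as) := ?xs ! length as]) = - \<phi> ?xs"
    using assms[unfolded alternating_def, rule_format, of "length as" ?xs "Suc (length as)"] by simp
  then show ?thesis
    by (simp add: list_update_append nth_append)
qed

lemma adjacent_move:
  fixes \<phi> :: "'v list \<Rightarrow> real"
  assumes "\<And>as x y bs. \<phi> (as @ x # y # bs) = - \<phi> (as @ y # x # bs)"
  shows "\<phi> (as @ x # bs @ cs) = (-1) ^ length bs * \<phi> (as @ bs @ x # cs)"
proof (induction bs arbitrary: as)
  case (Cons b bs)
  have "\<phi> (as @ x # (b # bs) @ cs) = - \<phi> ((as @ [b]) @ x # bs @ cs)"
    using assms[of as x b "bs @ cs"] by simp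
  then show ?case
    using Cons.IH[of "as @ [b]"] by simp
qed simp

lemma alternating_nth_to_front:
  assumes "alternating h" "i < length xs"
  shows "h (xs ! i # take i xs @ drop (Suc i) xs) = (-1) ^ i * h xs"
  using adjacent_move[of h "[]" "xs ! i" "take i xs" "drop (Suc i) xs", OF alternating_adjacent[OF assms(1)]]
    assms(2) by (simp add: id_take_nth_drop[symmetric] min_def)

text \<open>A swap of two arbitrary positions is a product of an odd number of adjacent swaps: one entry
  travels across the segment between the positions, past the other entry, which then travels back
  across the same segment.\<close>

lemma alternatingI:
  assumes adj: "\<And>as x y bs. \<phi> (as @ x # y # bs) = - \<phi> (as @ y # x # bs)"
  shows "alternating \<phi>"
proof -
  have less: "\<phi> (xs[i := xs ! j, j := xs ! i]) = - \<phi> xs" if "i < j" "j < length xs" for xs i j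
  proof -
    define as where "as = take i xs"
    define bs where "bs = take (j - Suc i) (drop (Suc i) xs)"
    define cs where "cs = drop (Suc j) xs"
    have "drop (Suc i) xs = bs @ xs ! j # cs"
      using that id_take_nth_drop[of "j - Suc i" "drop (Suc i) xs"] by (simp add: bs_def cs_def)
    then have xs: "xs = as @ xs ! i # bs @ xs ! j # cs"
      using that id_take_nth_drop[of i xs] by (simp add: as_def)
    have i: "length as = i" and j: "j = Suc (i + length bs)"
      using that by (simp_all add: as_def bs_def)
    have "xs[i := xs ! j, j := xs ! i] = as @ xs ! j # bs @ xs ! i # cs"
      by (subst (1) xs) (simp add: list_update_append i j)
    moreover have "\<phi> (as @ x # bs @ y # cs) = - \<phi> (as @ y # bs @ x # cs)" for x y
    proof -
      have "\<phi> (as @ x # bs @ y # cs) = (-1) ^ length bs * \<phi> ((as @ bs) @ x # y # cs)"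
        using adjacent_move[of \<phi>, OF adj, of as x bs "y # cs"] by simp
      also have "\<dots> = - ((-1) ^ length bs * \<phi> (as @ bs @ y # x # cs))"
        using adj[of "as @ bs" x y cs] by simp
      also have "\<dots> = - \<phi> (as @ y # bs @ x # cs)"
        using adjacent_move[of \<phi>, OF adj, of as y bs "x # cs"] by simp
      finally show ?thesis .
    qed
    ultimately show ?thesis
      using xs by metis
  qed
  show ?thesis
    unfolding alternating_def
  proof (intro allI impI)
    fix xs :: "'a list" and i j
    assume ij: "i < length xs" "j < length xs" "i \<noteq> j"
    then show "\<phi> (xs[i := xs ! j, j := xs ! i]) = - \<phi> xs"
      using less[of i j xs] less[of j i xs] by (metis linorder_neqE_nat list_update_swap)
  qed
qed

lemma alternating_Cons:
  assumes "alternating \<phi>"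
  shows "alternating (\<lambda>ys. \<phi> (v # ys))"
  by (intro alternatingI) (metis alternating_adjacent[OF assms] append_Cons)

lemma alternating_faces_sum:
  assumes "alternating \<phi>"
  shows "faces_sum \<phi> (as @ x # y # bs) = - faces_sum \<phi> (as @ y # x # bs)"
  using assms
proof (induction as arbitrary: \<phi>)
  case Nil
  have "\<phi> (x # y # zs) = (-1) * \<phi> (y # x # zs)" for zs
    using alternating_adjacent[OF Nil, of "[]" x y zs] by simp
  then have "faces_sum (\<lambda>zs. \<phi> (x # y # zs)) bs = - faces_sum (\<lambda>zs. \<phi> (y # x # zs)) bs"
    using faces_sum_scale[of "- 1" "\<lambda>zs. \<phi> (y # x # zs)" bs] by simp
  then show ?case
    by simp
next
  case (Cons a as)
  show ?case
    using Cons.IH[OF alternating_Cons[OF Cons.prems], of a] alternating_adjacent[OF Cons.prems, of as x y bs]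
    by simp
qed

lemma sum_lists_remove_nth:
  fixes F :: "'v::finite \<Rightarrow> 'v list \<Rightarrow> 'a::comm_monoid_add"
  assumes "i \<le> k"
  shows "(\<Sum>xs | length xs = Suc k. F (xs ! i) (take i xs @ drop (Suc i) xs))
    = (\<Sum>ys | length ys = k. \<Sum>v\<in>UNIV. F v ys)"
proof -
  have "(\<Sum>xs | length xs = Suc k. F (xs ! i) (take i xs @ drop (Suc i) xs))
     = (\<Sum>(ys, v)\<in>{ys. length ys = k} \<times> UNIV. F v ys)"
    using assms
    by (intro sum.reindex_bij_witness[where
          j = "\<lambda>xs. (take i xs @ drop (Suc i) xs, xs ! i)" and
          i = "\<lambda>(ys, v). take i ys @ v # drop i ys"])
      (auto simp: nth_append min_def id_take_nth_drop[symmetric] le_Suc_eq)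
  then show ?thesis
    by (simp add: sum.cartesian_product)
qed

text \<open>This is the adjunction between the coboundary and the contraction \<open>h \<mapsto> (\<Sum>v. h (v # ys))\<close>, where
  the sums run over all lists of the given length.\<close>

lemma sum_alternating_mult_faces_sum:
  fixes h g :: "'v::finite list \<Rightarrow> real"
  assumes "alternating h"
  shows "(\<Sum>xs | length xs = Suc k. h xs * faces_sum g xs)
    = (real k + 1) * (\<Sum>ys | length ys = k. (\<Sum>v\<in>UNIV. h (v # ys)) * g ys)"
proof -
  \<comment> \<open>The sign of the \<open>i\<close>-th face is the sign of moving the \<open>i\<close>-th vertex to the front, so every
    face contributes the same amount to the sum.\<close>
  have *: "h xs * ((-1) ^ i * g ys) = h (xs ! i # ys) * g ys"
    if "i < length xs" "ys = take i xs @ drop (Suc i) xs" for xs ys i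
    using alternating_nth_to_front[OF assms that(1)] that(2) by simp
  have "(\<Sum>xs | length xs = Suc k. h xs * faces_sum g xs)
     = (\<Sum>xs | length xs = Suc k. \<Sum>i\<le>k. h (xs ! i # take i xs @ drop (Suc i) xs) * g (take i xs @ drop (Suc i) xs))"
    by (intro sum.cong refl) (auto simp: faces_sum_def sum_distrib_left * lessThan_Suc_atMost intro!: sum.cong)
  also have "\<dots> = (\<Sum>i\<le>k. \<Sum>xs | length xs = Suc k. h (xs ! i # take i xs @ drop (Suc i) xs) * g (take i xs @ drop (Suc i) xs))"
    by (rule sum.swap)
  also have "\<dots> = (\<Sum>i\<le>k. \<Sum>ys | length ys = k. \<Sum>v\<in>UNIV. h (v # ys) * g ys)"
    by (intro sum.cong refl sum_lists_remove_nth) simp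
  finally show ?thesis
    by (simp add: sum_distrib_right add.commute)
qed

lemma sum_symmetric_mult_sum_list:
  fixes f :: "'v::finite \<Rightarrow> real"
  assumes "alternating h"
  shows "(\<Sum>xs | length xs = Suc k. (h xs)^2 * sum_list (map f xs))
    = (real k + 1) * (\<Sum>ys | length ys = k. \<Sum>v\<in>UNIV. f v * (h (v # ys))^2)"
proof -
  have *: "(h xs)^2 = (h (xs ! i # take i xs @ drop (Suc i) xs))^2" if "i < length xs" for xs i
    using alternating_nth_to_front[OF assms that] by (simp add: power_mult_distrib flip: power_mult)
  have "(\<Sum>xs | length xs = Suc k. (h xs)^2 * sum_list (map f xs))
     = (\<Sum>xs | length xs = Suc k. \<Sum>i\<le>k. f (xs ! i) * (h (xs ! i # take i xs @ drop (Suc i) xs))^2)"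
    by (intro sum.cong refl)
      (auto simp: sum_list_sum_nth sum_distrib_left atLeast0LessThan lessThan_Suc_atMost mult.commute
          simp flip: * intro!: sum.cong)
  also have "\<dots> = (\<Sum>i\<le>k. \<Sum>xs | length xs = Suc k. f (xs ! i) * (h (xs ! i # take i xs @ drop (Suc i) xs))^2)"
    by (rule sum.swap)
  also have "\<dots> = (\<Sum>i\<le>k. \<Sum>ys | length ys = k. \<Sum>v\<in>UNIV. f v * (h (v # ys))^2)"
    by (intro sum.cong refl sum_lists_remove_nth) simp
  finally show ?thesis
    by (simp add: add.commute)
qed

section \<open>Cochains, cocycles and coboundaries\<close>

lemma cochainsD:
  assumes "\<phi> \<in> cochains k K" "\<phi> xs \<noteq> 0"
  shows "distinct xs" "set xs \<in> K" "int (length xs) = k + 1"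
  using assms by (auto simp: cochains_def ordered_simplices_def)

lemma cochains_alternating: "\<phi> \<in> cochains k K \<Longrightarrow> alternating \<phi>"
  by (simp add: cochains_def)

lemma zero_in_cochains: "(\<lambda>_. 0) \<in> cochains k K"
  by (simp add: cochains_def alternating_def)

lemma cochains_add:
  assumes "\<phi> \<in> cochains k K" "\<psi> \<in> cochains k K"
  shows "(\<lambda>xs. \<phi> xs + \<psi> xs) \<in> cochains k K"
proof -
  have "alternating (\<lambda>xs. \<phi> xs + \<psi> xs)"
    using assms by (simp add: cochains_def alternating_def)
  moreover have "\<phi> xs \<noteq> 0 \<or> \<psi> xs \<noteq> 0" if "\<phi> xs + \<psi> xs \<noteq> 0" for xs
    using that by auto
  ultimately show ?thesis
    using assms unfolding cochains_def by blast
qed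

lemma cochains_scale:
  assumes "\<phi> \<in> cochains k K"
  shows "(\<lambda>xs. c * \<phi> xs) \<in> cochains k K"
  using assms by (auto simp: cochains_def alternating_def)

lemma coboundary_eq_faces_sum:
  "coboundary K \<phi> xs = (if xs \<in> ordered_simplices K then faces_sum \<phi> xs else 0)"
  by (simp add: coboundary_def faces_sum_def)

lemma coboundary_add:
  "coboundary K (\<lambda>xs. \<phi> xs + \<psi> xs) = (\<lambda>xs. coboundary K \<phi> xs + coboundary K \<psi> xs)"
  by (simp add: coboundary_eq_faces_sum faces_sum_add fun_eq_iff)

lemma coboundary_scale: "coboundary K (\<lambda>xs. c * \<phi> xs) = (\<lambda>xs. c * coboundary K \<phi> xs)"
  by (simp add: coboundary_eq_faces_sum faces_sum_scale fun_eq_iff)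

lemma coboundary_zero: "coboundary K (\<lambda>_. 0) = (\<lambda>_. 0)"
  by (simp add: coboundary_eq_faces_sum fun_eq_iff)

lemma cocycles_add:
  assumes "\<phi> \<in> cocycles k K" "\<psi> \<in> cocycles k K"
  shows "(\<lambda>xs. \<phi> xs + \<psi> xs) \<in> cocycles k K"
  using assms by (simp add: cocycles_def cochains_add coboundary_add)

lemma cocycles_scale: "\<phi> \<in> cocycles k K \<Longrightarrow> (\<lambda>xs. c * \<phi> xs) \<in> cocycles k K"
  by (simp add: cocycles_def cochains_scale coboundary_scale)

lemma zero_in_cocycles: "(\<lambda>_. 0) \<in> cocycles k K"
  by (simp add: cocycles_def zero_in_cochains coboundary_zero)

lemma zero_in_coboundaries: "(\<lambda>_. 0) \<in> coboundaries k K"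
  unfolding coboundaries_def
  by (rule image_eqI[where x = "\<lambda>_. 0"]) (simp_all add: coboundary_zero zero_in_cochains)

lemma coboundaries_add:
  assumes "f \<in> coboundaries k K" "g \<in> coboundaries k K"
  shows "(\<lambda>xs. f xs + g xs) \<in> coboundaries k K"
proof -
  obtain \<phi> \<psi> where "f = coboundary K \<phi>" "\<phi> \<in> cochains (k - 1) K"
      "g = coboundary K \<psi>" "\<psi> \<in> cochains (k - 1) K"
    using assms by (auto simp: coboundaries_def)
  then show ?thesis
    unfolding coboundaries_def by (auto simp flip: coboundary_add intro: cochains_add)
qed

lemma coboundaries_scale:
  assumes "f \<in> coboundaries k K"
  shows "(\<lambda>xs. c * f xs) \<in> coboundaries k K"
proof -
  obtain \<phi> where "f = coboundary K \<phi>" "\<phi> \<in> cochains (k - 1) K"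
    using assms by (auto simp: coboundaries_def)
  then show ?thesis
    unfolding coboundaries_def by (auto simp flip: coboundary_scale intro: cochains_scale)
qed

lemma face_in_ordered_simplices:
  assumes "\<forall>s\<in>K. \<forall>t\<subseteq>s. t \<in> K" and "xs \<in> ordered_simplices K"
  shows "take i xs @ drop (Suc i) xs \<in> ordered_simplices K"
proof -
  have "distinct (take i xs @ drop (Suc i) xs)"
    using assms(2) set_take_disj_set_drop_if_distinct[of xs i "Suc i"]
    by (simp add: ordered_simplices_def)
  moreover have "set (take i xs @ drop (Suc i) xs) \<subseteq> set xs"
    by (simp add: set_take_subset set_drop_subset)
  ultimately show ?thesis
    using assms unfolding ordered_simplices_def by blast
qed

lemma coboundary_coboundary:
  assumes "\<forall>s\<in>K. \<forall>t\<subseteq>s. t \<in> K"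
  shows "coboundary K (coboundary K \<phi>) = (\<lambda>_. 0)"
proof
  fix xs
  show "coboundary K (coboundary K \<phi>) xs = 0"
  proof (cases "xs \<in> ordered_simplices K")
    case True
    then have "coboundary K (coboundary K \<phi>) xs = faces_sum (faces_sum \<phi>) xs"
      using face_in_ordered_simplices[OF assms True]
      by (simp add: coboundary_eq_faces_sum faces_sum_def[of _ xs])
    then show ?thesis
      by (simp add: faces_sum_faces_sum)
  qed (simp add: coboundary_eq_faces_sum)
qed

lemma coboundary_in_cochains:
  assumes "\<phi> \<in> cochains (k - 1) K"
  shows "coboundary K \<phi> \<in> cochains k K"
proof -
  have "alternating (coboundary K \<phi>)"
  proof (rule alternatingI)
    fix as bs :: "'a list" and x y
    have "as @ x # y # bs \<in> ordered_simplices K \<longleftrightarrow> as @ y # x # bs \<in> ordered_simplices K"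
      by (auto simp: ordered_simplices_def insert_commute)
    then show "coboundary K \<phi> (as @ x # y # bs) = - coboundary K \<phi> (as @ y # x # bs)"
      using alternating_faces_sum[OF cochains_alternating[OF assms], of as x y bs]
      by (simp add: coboundary_eq_faces_sum)
  qed
  moreover have "xs \<in> ordered_simplices K \<and> int (length xs) = k + 1"
    if "coboundary K \<phi> xs \<noteq> 0" for xs
  proof -
    have xs: "xs \<in> ordered_simplices K" and "faces_sum \<phi> xs \<noteq> 0"
      using that by (auto simp: coboundary_eq_faces_sum split: if_splits)
    then obtain i where "i < length xs" "\<phi> (take i xs @ drop (Suc i) xs) \<noteq> 0"
      unfolding faces_sum_def by (metis (no_types, lifting) lessThan_iff mult_zero_right sum.neutral)
    then have "int (length xs) = k + 1"
      using cochainsD(3)[OF assms, of "take i xs @ drop (Suc i) xs"] by simp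
    then show ?thesis
      using xs by blast
  qed
  ultimately show ?thesis
    by (simp add: cochains_def)
qed

lemma coboundaries_subset_cocycles:
  assumes "\<forall>s\<in>K. \<forall>t\<subseteq>s. t \<in> K"
  shows "coboundaries k K \<subseteq> cocycles k K"
  unfolding coboundaries_def cocycles_def
  using coboundary_in_cochains coboundary_coboundary[OF assms] by blast

lemma group_cocycle_group: "group (cocycle_group k K)"
proof (rule groupI)
  fix \<phi>
  assume "\<phi> \<in> carrier (cocycle_group k K)"
  then have "(\<lambda>xs. - 1 * \<phi> xs) \<in> cocycles k K"
    unfolding cocycle_group_def partial_object.simps by (rule cocycles_scale)
  then show "\<exists>\<psi>\<in>carrier (cocycle_group k K).
      \<psi> \<otimes>\<^bsub>cocycle_group k K\<^esub> \<phi> = \<one>\<^bsub>cocycle_group k K\<^esub>"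
    by (intro bexI[of _ "\<lambda>xs. - 1 * \<phi> xs"]) (simp_all add: cocycle_group_def)
qed (auto simp: cocycle_group_def cocycles_add zero_in_cocycles add.assoc)

lemma trivial_group_Mod_carrier:
  assumes "group G"
  shows "trivial_group (G Mod carrier G)"
proof -
  interpret group G
    by fact
  have "(\<lambda>X. the_elem ((\<lambda>x. \<one>\<^bsub>G\<^esub>) ` X)) \<in> iso (G Mod carrier G) (G\<lparr>carrier := {\<one>\<^bsub>G\<^esub>}\<rparr>)"
    by (rule self_factor_iso)
  moreover have grp: "group (G Mod carrier G)"
    by (intro normal.factorgroup_is_group normal_self)
  moreover have "group (G\<lparr>carrier := {\<one>\<^bsub>G\<^esub>}\<rparr>)"
    using subgroup_imp_group[OF triv_subgroup] .
  ultimately have "(G Mod carrier G) \<cong> G\<lparr>carrier := {\<one>\<^bsub>G\<^esub>}\<rparr>"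
    by (auto simp: is_iso_def)
  then show ?thesis
    using isomorphic_group_triviality[OF _ grp \<open>group (G\<lparr>carrier := {\<one>\<^bsub>G\<^esub>}\<rparr>)\<close>]
      \<open>group (G\<lparr>carrier := {\<one>\<^bsub>G\<^esub>}\<rparr>)\<close>
    by (simp add: trivial_group_def)
qed

section \<open>Hodge decomposition of cocycles\<close>

text \<open>Orthogonal projection onto a subspace \<open>W\<close> of functions, for the inner product that sums over \<open>S\<close>.
  When a point \<open>a\<close> is added to \<open>S\<close>, inner products with functions that
  vanish at \<open>a\<close> do not change, so the induction hypothesis provides the projection onto the subspace
  \<open>W0\<close> of these functions. If \<open>W\<close> is larger, it is the sum of \<open>W0\<close> and the line spanned by a
  function \<open>e\<close> orthogonal to \<open>W0\<close>.\<close>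

lemma orthogonal_projection_function_space:
  fixes W :: "('a \<Rightarrow> real) set"
  assumes "finite S" and "(\<lambda>_. 0) \<in> W"
    and "\<And>f g. f \<in> W \<Longrightarrow> g \<in> W \<Longrightarrow> (\<lambda>x. f x + g x) \<in> W"
    and "\<And>c f. f \<in> W \<Longrightarrow> (\<lambda>x. c * f x) \<in> W"
  shows "\<exists>p\<in>W. \<forall>w\<in>W. (\<Sum>x\<in>S. (\<phi> x - p x) * w x) = 0"
  using assms
proof (induction S arbitrary: W \<phi> rule: finite_induct)
  case empty
  then show ?case
    by auto
next
  case (insert a S)
  note W = insert.prems
  define W0 where "W0 = {w \<in> W. w a = 0}"
  have proj: "\<exists>p\<in>W0. \<forall>w\<in>W0. (\<Sum>x\<in>S. (\<psi> x - p x) * w x) = 0" for \<psi>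
    by (rule insert.IH) (auto simp: W0_def W)
  obtain p where p: "p \<in> W0" "\<And>w. w \<in> W0 \<Longrightarrow> (\<Sum>x\<in>S. (\<phi> x - p x) * w x) = 0"
    using proj[of \<phi>] by blast
  show ?case
  proof (cases "W = W0")
    case True
    then show ?thesis
      using p insert.hyps by (intro bexI[of _ p]) (auto simp: W0_def)
  next
    case False
    then obtain g where g: "g \<in> W" "g a \<noteq> 0"
      by (auto simp: W0_def)
    obtain q where q: "q \<in> W0" "\<And>w. w \<in> W0 \<Longrightarrow> (\<Sum>x\<in>S. (g x - q x) * w x) = 0"
      using proj[of g] by blast
    define e where "e = (\<lambda>x. g x + (-1) * q x)"
    have eW: "e \<in> W"
      unfolding e_def using g(1) q(1) by (intro W(2) W(3)) (auto simp: W0_def)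
    have ea: "e a \<noteq> 0"
      using g q by (simp add: e_def W0_def)
    define I where "I f h = (\<Sum>x\<in>insert a S. f x * h x)" for f h :: "'a \<Rightarrow> real"
    have eorth: "I e w = 0" if "w \<in> W0" for w
      using q(2)[OF that] that insert.hyps by (simp add: I_def e_def W0_def)
    have porth: "I (\<lambda>x. \<phi> x - p x) w = 0" if "w \<in> W0" for w
      using p(2)[OF that] that insert.hyps by (simp add: I_def W0_def)
    have "0 < e a * e a"
      using ea by (simp flip: power2_eq_square)
    moreover have "0 \<le> (\<Sum>x\<in>S. e x * e x)"
      by (simp add: sum_nonneg)
    ultimately have Iee: "I e e \<noteq> 0"
      using insert.hyps by (simp add: I_def)
    define c where "c = I (\<lambda>x. \<phi> x - p x) e / I e e"
    define r where "r = (\<lambda>x. p x + c * e x)"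
    have "r \<in> W"
      using p(1) eW W(2,3) by (simp add: r_def W0_def)
    moreover have "I (\<lambda>x. \<phi> x - r x) w = 0" if "w \<in> W" for w
    proof -
      define d where "d = w a / e a"
      define w0 where "w0 = (\<lambda>x. w x + (- d) * e x)"
      have w0: "w0 \<in> W0"
      proof -
        have "w0 \<in> W"
          unfolding w0_def by (intro W(2) W(3) that eW)
        then show ?thesis
          using ea by (simp add: W0_def) (simp add: w0_def d_def)
      qed
      have lin: "I (\<lambda>x. \<phi> x - r x) f = I (\<lambda>x. \<phi> x - p x) f - c * I e f" for f
        by (simp add: I_def r_def sum_distrib_left sum_subtractf[symmetric] algebra_simps
            del: sum.insert)
      have "I (\<lambda>x. \<phi> x - r x) w = I (\<lambda>x. \<phi> x - r x) w0 + d * I (\<lambda>x. \<phi> x - r x) e"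
        by (simp add: I_def w0_def sum_distrib_left sum.distrib[symmetric] algebra_simps
            del: sum.insert)
      also have "\<dots> = 0"
        using eorth[OF w0] porth[OF w0] Iee by (simp add: lin c_def)
      finally show ?thesis .
    qed
    ultimately show ?thesis
      unfolding I_def by blast
  qed
qed

text \<open>Hodge decomposition: the component \<open>h\<close> of \<open>\<phi>\<close> orthogonal to the coboundaries is coclosed. The
  contraction \<open>\<psi>\<close> of \<open>h\<close> is a \<open>(k - 1)\<close>-cochain, and by adjunction the inner product of \<open>h\<close> with the
  coboundary of \<open>\<psi>\<close> is \<open>k + 1\<close> times the squared norm of \<open>\<psi>\<close>.\<close>

lemma cocycle_eq_coboundary_plus_harmonic:
  fixes K :: "'v::finite set set" and k :: nat
  assumes K: "\<forall>s\<in>K. \<forall>t\<subseteq>s. t \<in> K" and \<phi>: "\<phi> \<in> cocycles (int k) K"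
  obtains p h where "p \<in> coboundaries (int k) K" "h \<in> cocycles (int k) K"
    "\<And>xs. \<phi> xs = p xs + h xs" "\<And>ys. (\<Sum>v\<in>UNIV. h (v # ys)) = 0"
proof -
  let ?S = "{xs :: 'v list. length xs = Suc k}" and ?W = "coboundaries (int k) K"
  have finite: "finite {xs :: 'v list. length xs = j}" for j
    using finite_lists_length_eq[of "UNIV :: 'v set" j] by simp
  have "\<exists>p\<in>?W. \<forall>w\<in>?W. (\<Sum>x\<in>?S. (\<phi> x - p x) * w x) = 0"
  proof (rule orthogonal_projection_function_space[OF finite zero_in_coboundaries])
    show "(\<lambda>x. f x + g x) \<in> ?W" if "f \<in> ?W" "g \<in> ?W" for f g
      using that by (rule coboundaries_add)
    show "(\<lambda>x. c * f x) \<in> ?W" if "f \<in> ?W" for c f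
      using that by (rule coboundaries_scale)
  qed
  then obtain p where p: "p \<in> ?W" and orth: "\<And>w. w \<in> ?W \<Longrightarrow> (\<Sum>x\<in>?S. (\<phi> x - p x) * w x) = 0"
    by blast
  define h where "h = (\<lambda>xs. \<phi> xs + (- 1) * p xs)"
  have h: "h \<in> cocycles (int k) K"
    unfolding h_def
    using cocycles_add[OF \<phi> cocycles_scale] coboundaries_subset_cocycles[OF K] p by blast
  then have hc: "h \<in> cochains (int k) K"
    by (simp add: cocycles_def)
  define \<psi> where "\<psi> ys = (\<Sum>v\<in>UNIV. h (v # ys))" for ys
  have \<psi>: "\<psi> \<in> cochains (int k - 1) K"
  proof -
    have "alternating \<psi>"
      unfolding \<psi>_def
      by (intro alternatingI)
        (metis (no_types, lifting) alternating_adjacent[OF alternating_Cons[OF cochains_alternating[OF hc]]]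
          sum.cong sum_negf)
    moreover have "ys \<in> ordered_simplices K \<and> int (length ys) = int k" if nz: "\<psi> ys \<noteq> 0" for ys
    proof -
      obtain v where "h (v # ys) \<noteq> 0"
        using nz unfolding \<psi>_def by (meson sum.not_neutral_contains_not_neutral)
      note v = cochainsD[OF hc this]
      have "set ys \<in> K"
        using K v(2) by (meson set_subset_Cons)
      then show ?thesis
        using v(1,3) by (simp add: ordered_simplices_def)
    qed
    ultimately show ?thesis
      by (simp add: cochains_def)
  qed
  have "0 = (\<Sum>xs\<in>?S. h xs * coboundary K \<psi> xs)"
    using orth[of "coboundary K \<psi>"] \<psi> by (simp add: coboundaries_def h_def)
  also have "\<dots> = (\<Sum>xs\<in>?S. h xs * faces_sum \<psi> xs)"
    using cochainsD[OF hc]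
    by (intro sum.cong) (auto simp: coboundary_eq_faces_sum ordered_simplices_def)
  also have "\<dots> = (real k + 1) * (\<Sum>ys | length ys = k. \<psi> ys * \<psi> ys)"
    unfolding sum_alternating_mult_faces_sum[OF cochains_alternating[OF hc]] \<psi>_def[symmetric] ..
  finally have "(\<Sum>ys | length ys = k. \<psi> ys * \<psi> ys) = 0"
    by simp
  then have "\<psi> ys = 0" if "length ys = k" for ys
    using that finite by (simp add: sum_nonneg_eq_0_iff)
  then have "\<psi> ys = 0" for ys
    using cochainsD(3)[OF \<psi>, of ys] by fastforce
  then show ?thesis
    using that[OF p h] by (simp add: h_def \<psi>_def)
qed

section \<open>Harmonic cochains of the flag complex\<close>

lemma flag_complex_face: "\<forall>s\<in>flag_complex E. \<forall>t\<subseteq>s. t \<in> flag_complex E"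
  unfolding flag_complex_def by blast

lemma sum_list_of_bool_le:
  assumes "xs \<noteq> []"
  shows "sum_list (map (\<lambda>x. of_bool (P x)) xs) \<le> real (length xs) - 1 + of_bool (\<forall>x\<in>set xs. P x)"
proof -
  have *: "sum_list (map (\<lambda>x. of_bool (P x)) ys) \<le> real (length ys)" for ys
    by (induction ys) auto
  show ?thesis
    using assms
  proof (induction xs rule: list_nonempty_induct)
    case (cons x xs)
    then show ?case
      using *[of xs] by (cases "\<forall>x\<in>set xs. P x") auto
  qed auto
qed

text \<open>A vertex adjacent to all \<open>k + 1\<close> entries of \<open>xs\<close> is counted \<open>k + 1\<close> times on the left, and the last
  sum compensates for the one excess; any other vertex is counted at most \<open>k\<close> times.\<close>

lemma sum_degrees_le:
  fixes E :: "'v::finite set set"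
  assumes "length xs = Suc k"
  shows "sum_list (map (\<lambda>u. real (vertex_degree E u)) xs)
    \<le> real k * real CARD('v) + (\<Sum>v\<in>UNIV. of_bool (\<forall>x\<in>set xs. {v, x} \<in> E))"
proof -
  have "sum_list (map (\<lambda>u. real (vertex_degree E u)) xs)
      = (\<Sum>v\<in>UNIV. sum_list (map (\<lambda>x. of_bool ({v, x} \<in> E)) xs))"
    unfolding vertex_degree_eq_sum by (induction xs) (simp_all add: sum.distrib insert_commute)
  also have "\<dots> \<le> (\<Sum>v\<in>UNIV. real k + of_bool (\<forall>x\<in>set xs. {v, x} \<in> E))"
  proof (rule sum_mono)
    fix v
    have "xs \<noteq> []"
      using assms by auto
    from sum_list_of_bool_le[OF this, of "\<lambda>x. {v, x} \<in> E"]
    show "sum_list (map (\<lambda>x. of_bool ({v, x} \<in> E)) xs) \<le> real k + of_bool (\<forall>x\<in>set xs. {v, x} \<in> E)"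
      by (simp add: assms)
  qed
  finally show ?thesis
    by (simp add: sum.distrib mult.commute)
qed

text \<open>If \<open>v\<close> is adjacent to all entries of an ordered simplex \<open>xs\<close>, then \<open>v # xs\<close> is an ordered simplex
  of the flag complex, and the cocycle condition there expresses \<open>h xs\<close> through the values of \<open>h\<close> at
  \<open>v\<close> followed by the faces of \<open>xs\<close>. For each \<open>v\<close> the restriction \<open>r v\<close> of \<open>h\<close> to the lists in the
  neighbourhood of \<open>v\<close> is again alternating, so the adjunction turns the resulting sum over faces into
  a sum over \<open>ys\<close>. In this sum the common neighbour condition reduces to \<open>{u, w} \<in> E\<close>, because
  \<open>h (u # ys) \<noteq> 0\<close> makes \<open>u\<close> adjacent to all of \<open>ys\<close>.\<close>

lemma sum_common_neighbours_cocycle: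
  fixes E :: "'v::finite set set"
  assumes E: "simple_graph E" and h: "h \<in> cocycles (int k) (flag_complex E)"
  shows "(\<Sum>xs | length xs = Suc k. (h xs)^2 * (\<Sum>v\<in>UNIV. of_bool (\<forall>x\<in>set xs. {v, x} \<in> E)))
    = (real k + 1) * (\<Sum>ys | length ys = k. \<Sum>u\<in>UNIV. \<Sum>w\<in>UNIV.
        of_bool ({u, w} \<in> E) * (h (u # ys) * h (w # ys)))"
proof -
  have hc: "h \<in> cochains (int k) (flag_complex E)"
    and closed: "coboundary (flag_complex E) h xs = 0" for xs
    using h by (simp_all add: cocycles_def fun_eq_iff)
  note alt = cochains_alternating[OF hc]
  define r where "r v xs = of_bool (\<forall>x\<in>set xs. {v, x} \<in> E) * h xs" for v xs
  have r_alt: "alternating (r v)" for v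
  proof (rule alternatingI)
    fix as bs :: "'v list" and x y
    have "set (as @ x # y # bs) = set (as @ y # x # bs)"
      by auto
    then show "r v (as @ x # y # bs) = - r v (as @ y # x # bs)"
      using alternating_adjacent[OF alt, of as x y bs] by (simp only: r_def mult_minus_right)
  qed
  have r_cocycle: "r v xs * h xs = r v xs * faces_sum (\<lambda>ys. h (v # ys)) xs" for v xs
  proof (cases "h xs = 0 \<or> \<not> (\<forall>x\<in>set xs. {v, x} \<in> E)")
    case False
    have "v \<notin> set xs"
      using False E by (fastforce simp: simple_graph_def)
    then have "v # xs \<in> ordered_simplices (flag_complex E)"
      using cochainsD[OF hc, of xs] False
      by (auto simp: ordered_simplices_def flag_complex_def insert_commute)
    then show ?thesis
      using closed[of "v # xs"] by (simp add: coboundary_eq_faces_sum)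
  qed (auto simp: r_def)
  have r_Cons: "r u (w # ys) * h (u # ys) = of_bool ({u, w} \<in> E) * (h (u # ys) * h (w # ys))" for u w ys
  proof (cases "h (u # ys) = 0")
    case False
    then have "\<forall>x\<in>set ys. {u, x} \<in> E"
      using cochainsD[OF hc False] by (auto simp: flag_complex_def)
    then show ?thesis
      by (simp add: r_def)
  qed simp
  have "(\<Sum>xs | length xs = Suc k. (h xs)^2 * (\<Sum>v\<in>UNIV. of_bool (\<forall>x\<in>set xs. {v, x} \<in> E)))
      = (\<Sum>xs | length xs = Suc k. \<Sum>v\<in>UNIV. r v xs * h xs)"
    unfolding sum_distrib_left r_def by (simp only: power2_eq_square mult_ac)
  also have "\<dots> = (\<Sum>v\<in>UNIV. \<Sum>xs | length xs = Suc k. r v xs * faces_sum (\<lambda>ys. h (v # ys)) xs)"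
    unfolding r_cocycle by (rule sum.swap)
  also have "\<dots> = (\<Sum>u\<in>UNIV. (real k + 1) * (\<Sum>ys | length ys = k. \<Sum>w\<in>UNIV.
        of_bool ({u, w} \<in> E) * (h (u # ys) * h (w # ys))))"
    unfolding sum_alternating_mult_faces_sum[OF r_alt] sum_distrib_right r_Cons ..
  also have "\<dots> = (real k + 1) * (\<Sum>ys | length ys = k. \<Sum>u\<in>UNIV. \<Sum>w\<in>UNIV.
        of_bool ({u, w} \<in> E) * (h (u # ys) * h (w # ys)))"
    unfolding sum_distrib_left[symmetric] by (subst sum.swap) (rule refl)
  finally show ?thesis .
qed

text \<open>The Bochner inequality: the spectral gap is applied to \<open>u \<mapsto> h (u # ys)\<close> for each \<open>ys\<close>, and the
  sum over all \<open>ys\<close> is rewritten as a sum over the lists \<open>xs\<close> of length \<open>k + 1\<close>.\<close>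

lemma laplacian_eigenvalue_2_mult_norm_harmonic_le:
  fixes E :: "'v::finite set set"
  assumes E: "simple_graph E" and h: "h \<in> cocycles (int k) (flag_complex E)"
    and coclosed: "\<And>ys. (\<Sum>v\<in>UNIV. h (v # ys)) = 0"
  shows "(real k + 1) * laplacian_eigenvalue 2 E * (\<Sum>xs | length xs = Suc k. (h xs)^2)
    \<le> real k * real CARD('v) * (\<Sum>xs | length xs = Suc k. (h xs)^2)"
proof -
  let ?lambda = "laplacian_eigenvalue 2 E" and ?deg = "\<lambda>u. real (vertex_degree E u)"
  let ?N = "\<Sum>xs | length xs = Suc k. (h xs)^2"
  let ?T = "\<Sum>ys | length ys = k. \<Sum>u\<in>UNIV. \<Sum>w\<in>UNIV. of_bool ({u, w} \<in> E) * (h (u # ys) * h (w # ys))"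
  let ?common = "\<lambda>xs. \<Sum>v\<in>UNIV. of_bool (\<forall>x\<in>set xs. {v, x} \<in> E) :: real"
  have alt: "alternating h"
    using h by (auto simp: cocycles_def cochains_def)
  have link_bound: "?lambda * (\<Sum>u\<in>UNIV. 1 * (h (u # ys))^2) \<le> (\<Sum>u\<in>UNIV. ?deg u * (h (u # ys))^2)
      - (\<Sum>u\<in>UNIV. \<Sum>w\<in>UNIV. of_bool ({u, w} \<in> E) * (h (u # ys) * h (w # ys)))" for ys
  proof -
    let ?f = "(\<chi> v. h (v # ys)) :: real ^ 'v"
    have "?lambda * (?f \<bullet> ?f) \<le> ?f \<bullet> (laplacian E *v ?f)"
      using coclosed by (intro laplacian_eigenvalue_2_le E) simp
    also have "\<dots> = (\<Sum>u\<in>UNIV. ?deg u * (h (u # ys))^2)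
      - (\<Sum>u\<in>UNIV. \<Sum>w\<in>UNIV. of_bool ({u, w} \<in> E) * (h (u # ys) * h (w # ys)))"
      unfolding laplacian_quadratic_form[OF E] vertex_degree_eq_sum sum_distrib_right
        sum_subtractf[symmetric]
      by (intro sum.cong refl) (auto simp: power2_eq_square algebra_simps)
    finally show ?thesis
      by (simp add: inner_vec_def power2_eq_square)
  qed
  have N: "(real k + 1) * ?N = (real k + 1) * (\<Sum>ys | length ys = k. \<Sum>u\<in>UNIV. 1 * (h (u # ys))^2)"
  proof -
    have "(real k + 1) * ?N = (\<Sum>xs | length xs = Suc k. (h xs)^2 * sum_list (map (\<lambda>_. 1) xs))"
      unfolding sum_distrib_left
      by (intro sum.cong refl) (simp add: sum_list_triv add.commute mult.commute)
    also note sum_symmetric_mult_sum_list[OF alt]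
    finally show ?thesis .
  qed
  have "(real k + 1) * ?lambda * ?N = ?lambda * ((real k + 1) * ?N)"
    by simp
  also have "\<dots> = (real k + 1) * (\<Sum>ys | length ys = k. ?lambda * (\<Sum>u\<in>UNIV. 1 * (h (u # ys))^2))"
    unfolding N sum_distrib_left[symmetric] by simp
  also have "\<dots> \<le> (real k + 1) * (\<Sum>ys | length ys = k. (\<Sum>u\<in>UNIV. ?deg u * (h (u # ys))^2)
      - (\<Sum>u\<in>UNIV. \<Sum>w\<in>UNIV. of_bool ({u, w} \<in> E) * (h (u # ys) * h (w # ys))))"
    by (intro mult_left_mono sum_mono link_bound) simp
  also have "\<dots> = (\<Sum>xs | length xs = Suc k. (h xs)^2 * sum_list (map ?deg xs))
      - (\<Sum>xs | length xs = Suc k. (h xs)^2 * ?common xs)"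
    unfolding sum_symmetric_mult_sum_list[OF alt] sum_common_neighbours_cocycle[OF E h]
    by (simp only: sum_subtractf right_diff_distrib)
  also have "\<dots> = (\<Sum>xs | length xs = Suc k. (h xs)^2 * (sum_list (map ?deg xs) - ?common xs))"
    by (simp only: sum_subtractf right_diff_distrib)
  also have "\<dots> \<le> (\<Sum>xs | length xs = Suc k. (h xs)^2 * (real k * real CARD('v)))"
    using sum_degrees_le[of _ k E] by (intro sum_mono mult_left_mono) (auto simp: algebra_simps)
  finally show ?thesis
    by (simp add: sum_distrib_left mult.commute)
qed

theorem theorem1p2:
  fixes E :: "'v::finite set set" and k :: nat
  assumes "simple_graph E"
    and "CARD('v) \<ge> 2"
    and "laplacian_eigenvalue 2 E > real k * real CARD('v) / (real k + 1)"
  shows "trivial_group (reduced_cohomology_group (int k) (flag_complex E))"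
proof -
  let ?K = "flag_complex E"
  have "\<phi> \<in> coboundaries (int k) ?K" if \<phi>: "\<phi> \<in> cocycles (int k) ?K" for \<phi>
  proof -
    obtain p h where p: "p \<in> coboundaries (int k) ?K" and h: "h \<in> cocycles (int k) ?K"
      and \<phi>_eq: "\<And>xs. \<phi> xs = p xs + h xs" and coclosed: "\<And>ys. (\<Sum>v\<in>UNIV. h (v # ys)) = 0"
      using cocycle_eq_coboundary_plus_harmonic[OF flag_complex_face \<phi>] by metis
    let ?N = "\<Sum>xs | length xs = Suc k. (h xs)^2"
    have "real k * real CARD('v) < (real k + 1) * laplacian_eigenvalue 2 E"
      using assms(3) by (simp add: field_simps)
    moreover have "(real k + 1) * laplacian_eigenvalue 2 E * ?N \<le> real k * real CARD('v) * ?N"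
      using laplacian_eigenvalue_2_mult_norm_harmonic_le[OF assms(1) h coclosed] .
    ultimately have "\<not> 0 < ?N"
      by (meson mult_strict_right_mono not_le)
    moreover have "0 \<le> ?N"
      by (simp add: sum_nonneg)
    ultimately have "?N = 0"
      by linarith
    then have "h xs = 0" if "length xs = Suc k" for xs
      using that finite_lists_length_eq[of "UNIV :: 'v set" "Suc k"] by (simp add: sum_nonneg_eq_0_iff)
    then have "h xs = 0" for xs
      using cochainsD(3)[of h "int k" ?K xs] h by (fastforce simp: cocycles_def)
    then have "\<phi> = p"
      using \<phi>_eq by auto
    then show ?thesis
      using p by simp
  qed
  then have "coboundaries (int k) ?K = carrier (cocycle_group (int k) ?K)"
    using coboundaries_subset_cocycles[OF flag_complex_face] by (auto simp: cocycle_group_def)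
  then show ?thesis
    unfolding reduced_cohomology_group_def
    by (simp add: trivial_group_Mod_carrier group_cocycle_group)
qed

end
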